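(* Let $\Gamma$ be a digraph satisfying P0, P1 and P2, with root $\alpha$. Then there is an integer $k\ge1$ satisfying condition G3 such that, with $\rho$ the equivalence relation defined below using this $k$: there is an integer $s\ge1$ such that for every $l\ge 2k-1$ and every $\rho$-class $\mathbf{w}\subseteq\Gamma^l(\alpha)$, the quotient digraph $T(\mathbf{w})/\rho$ is a rooted directed tree in which every vertex has out-valency $s$. In particular, for every $l\ge 2k-1$, the subdigraph induced on $\mathrm{desc}(\Gamma^l(\alpha))$ is the disjoint union of finitely many copies of a fixed digraph $T$, where $T$ is isomorphic to $T(\mathbf{w})$ for a $\rho$-class $\mathbf{w}$.
   Context: Digraphs have no loops; subdigraphs are induced. An $s$-arc from $u$ to $v$ is a sequence $u_0\dots u_s$ with $u_0=u$, $u_s=v$, consecutive pairs edges, and $u_{i-1}\ne u_{i+1}$ for $0<i<s$. In a digraph $\Gamma$, $\Gamma^i(u)$ denotes the set of vertices reachable from $u$ by an $i$-arc, $\mathrm{desc}(u)=\bigcup_{i\ge0}\Gamma^i(u)$, $\mathrm{desc}(X)=\bigcup_{x\in X}\mathrm{desc}(x)$, $\Gamma(u)$ is the subdigraph induced on $\mathrm{desc}(u)$, and $\mathrm{anc}(u)$ is the set of vertices $w$ with $u\in\mathrm{desc}(w)$. Properties: P0: $\Gamma=\Gamma(\alpha)$ (every vertex is a descendant of the root $\alpha$), every vertex has finite out-valency $m>0$, and $\Gamma^s(\alpha)\cap\Gamma^t(\alpha)=\varnothing$ for $s\ne t$. P1: $\Gamma(u)\cong\Gamma$ for all vertices $u$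 of $\Gamma$. P2: for each $i\ge0$, $\mathrm{Aut}(\Gamma)$ is transitive on $\Gamma^i(\alpha)$. G3 (for an integer $k\ge1$): if $l\ge k$, $x\in\Gamma^l(\alpha)$ and $z\in\mathrm{desc}(x)$, then $\mathrm{anc}(z)\cap\Gamma^1(\alpha)=\mathrm{anc}(x)\cap\Gamma^1(\alpha)$. Relation $\rho$: for $l\ge k$ and $x,y\in\Gamma^l(\alpha)$, $\rho(x,y)$ holds iff $x$ and $y$ have the same set of ancestors in $\Gamma^{l-k+1}(\alpha)$ (i.e. $\mathrm{anc}(x)\cap\Gamma^{l-k+1}(\alpha)=\mathrm{anc}(y)\cap\Gamma^{l-k+1}(\alpha)$); $\rho$ does not hold otherwise; it is an equivalence relation on $\bigcup_{l\ge k}\Gamma^l(\alpha)$. For a $\rho$-class $\mathbf{w}$, $T(\mathbf{w})$ is the subdigraph induced on $\mathrm{desc}(\mathbf{w})$ together with the restriction of $\rho$ (it is a union of $\rho$-classes), and $T(\mathbf{w})/\rho$ is the quotient digraph whose vertices are the $\rho$-classes contained in $\mathrm{desc}(\mathbf{w})$, with an edge $(A,B)$ iff there are $a\in A$, $b\in B$ with $(a,b)$ an edge.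
   Formalization: The formal statement additionally assumes that Γ has no directed 2-cycles; without this the claim is false, e.g. for the d-regular undirected tree (d ≥ 2) with every edge directed both ways, where T(w)/ρ is a ray with edges in both directions. *)

theory Defs
  imports "Graph_Theory.Graph_Theory" "HOL-Library.Disjoint_Sets"
begin

text \<open>
  The definition of s-arcs forbids immediate backtracking, whereas the theory of descendant sets
  developed here presupposes that edges lead from one level of the root to the next.  The two fit
  together only for digraphs without directed 2-cycles: the d-regular undirected tree (d at least
  2), with every edge directed both ways, is loop-free and satisfies P0, P1 and P2 with any vertex
  as root, but all its vertices are ancestors of one another, so that the quotients considered
  below are not directed trees.  A digraph is therefore an asymmetric relation, and asymmetry is
  an explicit hypothesis in what follows.  It makes the non-backtracking condition automatic.
\<close>

definition is_sarc :: "('a,'b) pre_digraph \<Rightarrow> nat \<Rightarrow> 'a \<Rightarrow> 'a list \<Rightarrow> 'a \<Rightarrow> bool" where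
  "is_sarc G s u p v \<longleftrightarrow>
     vwalk p G \<and> length p = s + 1 \<and> hd p = u \<and> last p = v \<and>
     (\<forall>i. 0 < i \<and> i < s \<longrightarrow> p ! (i - 1) \<noteq> p ! (i + 1))"

definition desc_at :: "('a,'b) pre_digraph \<Rightarrow> nat \<Rightarrow> 'a \<Rightarrow> 'a set" where
  "desc_at G i u = {v. \<exists>p. is_sarc G i u p v}"

definition desc :: "('a,'b) pre_digraph \<Rightarrow> 'a \<Rightarrow> 'a set" where
  "desc G u = (\<Union>i. desc_at G i u)"

definition desc_set :: "('a,'b) pre_digraph \<Rightarrow> 'a set \<Rightarrow> 'a set" where
  "desc_set G X = (\<Union>x\<in>X. desc G x)"

definition anc :: "('a,'b) pre_digraph \<Rightarrow> 'a \<Rightarrow> 'a set" where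
  "anc G u = {w \<in> verts G. u \<in> desc G w}"

definition has_out_valency :: "('a,'b) pre_digraph \<Rightarrow> nat \<Rightarrow> bool" where
  "has_out_valency G m \<longleftrightarrow> (\<forall>v\<in>verts G. finite (out_arcs G v) \<and> out_degree G v = m)"

definition is_automorphism ::
    "('a,'b) pre_digraph \<Rightarrow> ('a,'b,'a,'b) digraph_isomorphism \<Rightarrow> bool" where
  "is_automorphism G h \<longleftrightarrow> pre_digraph.digraph_isomorphism G h \<and> app_iso h G = G"

definition P0 :: "('a,'b) pre_digraph \<Rightarrow> 'a \<Rightarrow> bool" where
  "P0 G \<alpha> \<longleftrightarrow>
     \<alpha> \<in> verts G \<and> G = G \<restriction> desc G \<alpha> \<and>
     (\<exists>m>0. has_out_valency G m) \<and>
     (\<forall>s t. s \<noteq> t \<longrightarrow> desc_at G s \<alpha> \<inter> desc_at G t \<alpha> = {})"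

definition P1 :: "('a,'b) pre_digraph \<Rightarrow> bool" where
  "P1 G \<longleftrightarrow> (\<forall>u\<in>verts G. digraph_iso (G \<restriction> desc G u) G)"

definition P2 :: "('a,'b) pre_digraph \<Rightarrow> 'a \<Rightarrow> bool" where
  "P2 G \<alpha> \<longleftrightarrow>
     (\<forall>i. \<forall>x\<in>desc_at G i \<alpha>. \<forall>y\<in>desc_at G i \<alpha>. \<exists>h. is_automorphism G h \<and> iso_verts h x = y)"

definition G3 :: "('a,'b) pre_digraph \<Rightarrow> 'a \<Rightarrow> nat \<Rightarrow> bool" where
  "G3 G \<alpha> k \<longleftrightarrow>
     (\<forall>l\<ge>k. \<forall>x\<in>desc_at G l \<alpha>. \<forall>z\<in>desc G x.
        anc G z \<inter> desc_at G 1 \<alpha> = anc G x \<inter> desc_at G 1 \<alpha>)"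

definition rho :: "('a,'b) pre_digraph \<Rightarrow> 'a \<Rightarrow> nat \<Rightarrow> 'a rel" where
  "rho G \<alpha> k =
     {(x, y). \<exists>l\<ge>k. x \<in> desc_at G l \<alpha> \<and> y \<in> desc_at G l \<alpha> \<and>
        anc G x \<inter> desc_at G (l - k + 1) \<alpha> = anc G y \<inter> desc_at G (l - k + 1) \<alpha>}"

definition rho_classes :: "('a,'b) pre_digraph \<Rightarrow> 'a \<Rightarrow> nat \<Rightarrow> 'a set set" where
  "rho_classes G \<alpha> k = (\<Union>l\<in>{k..}. desc_at G l \<alpha>) // rho G \<alpha> k"

definition T_of :: "('a,'b) pre_digraph \<Rightarrow> 'a set \<Rightarrow> ('a,'b) pre_digraph" where
  "T_of G w = G \<restriction> desc_set G w"

definition quotient_digraph :: "('a,'b) pre_digraph \<Rightarrow> 'a set set \<Rightarrow> 'a set pair_pre_digraph" where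
  "quotient_digraph H C =
     \<lparr> pverts = {A \<in> C. A \<subseteq> verts H},
       parcs = {(A, B). A \<in> C \<and> A \<subseteq> verts H \<and> B \<in> C \<and> B \<subseteq> verts H \<and>
                  (\<exists>a\<in>A. \<exists>b\<in>B. (a, b) \<in> arcs_ends H)} \<rparr>"

text \<open>
  The constant \<^const>\<open>tree\<close> is meant for symmetric digraphs (its acyclicity condition only concerns
  directed cycles), hence the usual definition of a rooted directed tree: exactly one directed
  walk leads from the root to any given vertex.
\<close>

definition rooted_directed_tree :: "('a,'b) pre_digraph \<Rightarrow> bool" where
  "rooted_directed_tree G \<longleftrightarrow>
     wf_digraph G \<and> (\<exists>r\<in>verts G. \<forall>v\<in>verts G. \<exists>!p. pre_digraph.awalk G r p v)"

definition finite_disjoint_union_of_copies ::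
    "('a,'b) pre_digraph \<Rightarrow> ('c,'d) pre_digraph \<Rightarrow> bool" where
  "finite_disjoint_union_of_copies H T \<longleftrightarrow>
     (\<exists>P. finite P \<and> partition_on (verts H) P \<and>
        (\<forall>e\<in>arcs H. \<exists>X\<in>P. tail H e \<in> X \<and> head H e \<in> X) \<and>
        (\<forall>X\<in>P. digraph_iso T (H \<restriction> X)))"

end

theory Submission
  imports Defs
begin

text \<open>
  Write \<open>L i\<close> for the levels of the root. The number of ancestors in the first level is
  constant on each level, nondecreasing and bounded, so it becomes stable at some level \<open>k\<close>;
  applying this below every vertex, a vertex of level \<open>l \<ge> k\<close> and its descendants have the same
  ancestors up to level \<open>l - k + 1\<close>. Hence a class of level above \<open>k\<close> has only one parent
  class, which makes the quotients trees and the descendant sets of distinct classes disjoint.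
  For a vertex \<open>u\<close> of level \<open>d\<close> and a descendant \<open>x\<close> of \<open>u\<close> of level at least
  \<open>2 * k - 1 + d\<close>, all the ancestors of \<open>x\<close> that determine its class are themselves descendants
  of \<open>u\<close>. Isomorphisms from the descendants of \<open>u\<close> to the whole digraph therefore map classes to
  classes, and every class of level at least \<open>2 * k - 1\<close> looks like a fixed one of level
  \<open>2 * k - 1\<close>.
\<close>

section \<open>Walks, directed trees and isomorphisms of induced subdigraphs\<close>

lemma vwalk_imp_relpow:
  assumes "vwalk p G"
  shows "(hd p, last p) \<in> arcs_ends G ^^ (length p - 1)"
  using assms
proof (induction p rule: vwalk_induct)
  case (Cons u v es)
  then have "(u, last (v # es)) \<in> arcs_ends G ^^ Suc (length es)"
    by (intro relpow_Suc_I2) auto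
  then show ?case
    by simp
qed simp

lemma (in wf_digraph) relpow_imp_vwalk:
  assumes "(u, v) \<in> arcs_ends G ^^ n" "u \<in> verts G"
  shows "\<exists>p. vwalk p G \<and> length p = n + 1 \<and> hd p = u \<and> last p = v"
  using assms
proof (induction n arbitrary: u)
  case 0
  then show ?case
    by (intro exI[of _ "[u]"]) (auto simp: vwalk_def)
next
  case (Suc n)
  obtain w where w: "(u, w) \<in> arcs_ends G" "(w, v) \<in> arcs_ends G ^^ n"
    using relpow_Suc_D2[OF Suc.prems(1)] by blast
  moreover have "w \<in> verts G"
    using w(1) by auto
  ultimately obtain p where p: "vwalk p G" "length p = n + 1" "hd p = w" "last p = v"
    using Suc.IH by blast
  then have "p \<noteq> []" by auto
  then show ?case
    using p w(1) by (intro exI[of _ "u # p"]) (auto intro: vwalk_wf_digraph_consI)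
qed

lemma vwalk_nth_arc:
  assumes "vwalk p G" "Suc i < length p"
  shows "(p ! i, p ! Suc i) \<in> arcs_ends G"
  using assms
proof (induction p arbitrary: i rule: vwalk_induct)
  case (Cons u v es)
  then show ?case
    by (cases i) auto
qed simp

text \<open>Two consecutive edges of an asymmetric relation cannot return to their starting point,
  so every walk of length \<open>i\<close> is an \<open>i\<close>-arc. This reduces arcs to plain
  powers of the edge relation.\<close>

lemma desc_at_eq_relpow:
  assumes "wf_digraph G" "asym (arcs_ends G)" "u \<in> verts G"
  shows "desc_at G i u = {v. (u, v) \<in> arcs_ends G ^^ i}"
proof (intro equalityI subsetI)
  fix v assume "v \<in> desc_at G i u"
  then obtain p where "vwalk p G" "length p = i + 1" "hd p = u" "last p = v"
    by (auto simp: desc_at_def is_sarc_def)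
  then show "v \<in> {v. (u, v) \<in> arcs_ends G ^^ i}"
    using vwalk_imp_relpow[of p G] by simp
next
  fix v assume "v \<in> {v. (u, v) \<in> arcs_ends G ^^ i}"
  then obtain p where p: "vwalk p G" "length p = i + 1" "hd p = u" "last p = v"
    using wf_digraph.relpow_imp_vwalk[OF assms(1) _ assms(3)] by blast
  have "p ! (j - 1) \<noteq> p ! (j + 1)" if "0 < j" "j < i" for j
    using vwalk_nth_arc[OF p(1), of "j - 1"] vwalk_nth_arc[OF p(1), of j] that p(2) assms(2)
    by (auto dest: asymD)
  then show "v \<in> desc_at G i u"
    using p by (auto simp: desc_at_def is_sarc_def)
qed

text \<open>Two nonempty walks from \<open>r\<close> to the same vertex end in the same arc, because
  \<open>head\<close> is injective on arcs; stripping it and inducting shows that they coincide. As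
  no arc enters \<open>r\<close>, neither walk can outlast the other.\<close>

lemma rooted_directed_treeI:
  assumes "wf_digraph G" and r: "r \<in> verts G"
    and reach: "\<And>v. v \<in> verts G \<Longrightarrow> \<exists>p. pre_digraph.awalk G r p v"
    and root: "\<And>e. e \<in> arcs G \<Longrightarrow> head G e \<noteq> r"
    and inj: "inj_on (head G) (arcs G)"
  shows "rooted_directed_tree G"
proof -
  interpret wf_digraph G by fact
  \<comment> \<open>The hypotheses control the arcs entering a vertex, so walks are taken apart at
    their last arc.\<close>
  have awalk_snoc: "awalk u (p @ [e]) v \<longleftrightarrow> awalk u p (tail G e) \<and> e \<in> arcs G \<and> head G e = v" for u p e v
    by (auto simp: awalk_Cons_iff awalk_Nil_iff)
  have "p = q" if "awalk r p v" "awalk r q v" for p q v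
    using that
  proof (induction p arbitrary: q v rule: rev_induct)
    case Nil
    then have "v = r"
      by (auto simp: awalk_Nil_iff)
    then show ?case
      using Nil(2) root by (cases q rule: rev_cases) (auto simp: awalk_snoc simp del: awalk_append_iff)
  next
    case (snoc e p)
    then have e: "awalk r p (tail G e)" "e \<in> arcs G" "head G e = v"
      by (auto simp: awalk_snoc simp del: awalk_append_iff)
    then have "q \<noteq> []"
      using snoc.prems(2) root[OF e(2)] by (auto simp: awalk_Nil_iff)
    then obtain q' e' where q: "q = q' @ [e']"
      by (cases q rule: rev_cases) auto
    then have e': "awalk r q' (tail G e')" "e' \<in> arcs G" "head G e' = v"
      using snoc.prems(2) by (auto simp: awalk_snoc simp del: awalk_append_iff)
    have "e = e'"
      using inj_onD[OF inj] e(2,3) e'(2,3) by simp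
    then show ?case
      using snoc.IH[OF e(1)] e'(1) q by simp
  qed
  then have "\<exists>!p. awalk r p v" if "v \<in> verts G" for v
    using reach[OF that] by blast
  then show ?thesis
    unfolding rooted_directed_tree_def using r wf_digraph_axioms by blast
qed

text \<open>Arcs of \<open>with_proj \<Gamma>\<close> are pairs of vertices, so the vertex map
  \<open>\<phi>\<close> already determines an arc map, namely
  \<open>map_prod \<phi> \<phi>\<close>.\<close>

lemma digraph_iso_induceI:
  assumes "wf_digraph (with_proj \<Gamma>)" and bij: "bij_betw \<phi> X Y"
    and edges: "\<And>a b. a \<in> X \<Longrightarrow> b \<in> X \<Longrightarrow> (a, b) \<in> parcs \<Gamma> \<longleftrightarrow> (\<phi> a, \<phi> b) \<in> parcs \<Gamma>"
  shows "digraph_iso (with_proj \<Gamma> \<restriction> X) (with_proj \<Gamma> \<restriction> Y)"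
proof -
  define f :: "('a, 'a \<times> 'a, 'a, 'a \<times> 'a) digraph_isomorphism"
    where "f = \<lparr>iso_verts = \<phi>, iso_arcs = map_prod \<phi> \<phi>, iso_head = snd, iso_tail = fst\<rparr>"
  have inj: "inj_on \<phi> X" and img: "\<phi> ` X = Y"
    using bij by (auto simp: bij_betw_def)
  have "inj_on (map_prod \<phi> \<phi>) (arcs (with_proj \<Gamma> \<restriction> X))"
    by (rule inj_on_subset[OF map_prod_inj_on[OF inj inj]]) auto
  then have "pre_digraph.digraph_isomorphism (with_proj \<Gamma> \<restriction> X) f"
    using inj wf_digraph.wellformed_induce_subgraph[OF assms(1)]
    by (auto simp: pre_digraph.digraph_isomorphism_def f_def)
  moreover have "map_prod \<phi> \<phi> ` arcs (with_proj \<Gamma> \<restriction> X) = arcs (with_proj \<Gamma> \<restriction> Y)"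
  proof
    show "map_prod \<phi> \<phi> ` arcs (with_proj \<Gamma> \<restriction> X) \<subseteq> arcs (with_proj \<Gamma> \<restriction> Y)"
      using edges img by auto
    show "arcs (with_proj \<Gamma> \<restriction> Y) \<subseteq> map_prod \<phi> \<phi> ` arcs (with_proj \<Gamma> \<restriction> X)"
    proof
      fix e assume "e \<in> arcs (with_proj \<Gamma> \<restriction> Y)"
      then obtain a b where "e = (\<phi> a, \<phi> b)" "a \<in> X" "b \<in> X" "(\<phi> a, \<phi> b) \<in> parcs \<Gamma>"
        using img by (cases e) auto
      then show "e \<in> map_prod \<phi> \<phi> ` arcs (with_proj \<Gamma> \<restriction> X)"
        using edges by (intro image_eqI[of _ _ "(a, b)"]) auto
    qed
  qed
  then have "with_proj \<Gamma> \<restriction> Y = app_iso f (with_proj \<Gamma> \<restriction> X)"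
    using img by (intro pre_digraph.equality) (simp_all add: f_def)
  ultimately show ?thesis
    unfolding digraph_iso_def by blast
qed

text \<open>An isomorphism brings its own arc map and end maps. Since its image is
  \<open>with_proj \<Gamma>\<close> itself, the end maps must be \<open>fst\<close> and
  \<open>snd\<close>, and the arc map then agrees with the vertex map on both ends. Afterwards only
  vertex maps have to be handled.\<close>

lemma induced_isoD:
  assumes f: "pre_digraph.digraph_isomorphism (with_proj \<Gamma> \<restriction> X) f"
    and app: "app_iso f (with_proj \<Gamma> \<restriction> X) = with_proj \<Gamma>"
  shows "bij_betw (iso_verts f) X (pverts \<Gamma>)"
    and "a \<in> X \<Longrightarrow> b \<in> X \<Longrightarrow> (a, b) \<in> parcs \<Gamma> \<longleftrightarrow> (iso_verts f a, iso_verts f b) \<in> parcs \<Gamma>"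
proof -
  have inj: "inj_on (iso_verts f) X"
    using f by (auto simp: pre_digraph.digraph_isomorphism_def)
  have img: "iso_verts f ` X = pverts \<Gamma>" "iso_arcs f ` arcs (with_proj \<Gamma> \<restriction> X) = parcs \<Gamma>"
    and ends: "iso_tail f = fst" "iso_head f = snd"
    using arg_cong[OF app, of verts] arg_cong[OF app, of arcs]
      arg_cong[OF app, of tail] arg_cong[OF app, of head] by simp_all
  show "bij_betw (iso_verts f) X (pverts \<Gamma>)"
    using inj img(1) by (simp add: bij_betw_def)
  have arc: "iso_arcs f (a, b) = (iso_verts f a, iso_verts f b)"
    if "(a, b) \<in> parcs \<Gamma>" "a \<in> X" "b \<in> X" for a b
  proof -
    have "(a, b) \<in> arcs (with_proj \<Gamma> \<restriction> X)"
      using that by simp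
    then have "iso_verts f a = fst (iso_arcs f (a, b))" "iso_verts f b = snd (iso_arcs f (a, b))"
      using f ends by (auto simp: pre_digraph.digraph_isomorphism_def)
    then show ?thesis by simp
  qed
  show "(a, b) \<in> parcs \<Gamma> \<longleftrightarrow> (iso_verts f a, iso_verts f b) \<in> parcs \<Gamma>"
    if ab: "a \<in> X" "b \<in> X"
  proof
    assume "(a, b) \<in> parcs \<Gamma>"
    then have "iso_arcs f (a, b) \<in> iso_arcs f ` arcs (with_proj \<Gamma> \<restriction> X)"
      using ab by (intro imageI) simp
    then show "(iso_verts f a, iso_verts f b) \<in> parcs \<Gamma>"
      using arc[OF \<open>(a, b) \<in> parcs \<Gamma>\<close> ab] img(2) by simp
  next
    assume "(iso_verts f a, iso_verts f b) \<in> parcs \<Gamma>"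
    then obtain e where e: "e \<in> arcs (with_proj \<Gamma> \<restriction> X)" "iso_arcs f e = (iso_verts f a, iso_verts f b)"
      using img(2) by (metis imageE)
    obtain c d where cd: "e = (c, d)" by fastforce
    then have "iso_verts f c = iso_verts f a" "iso_verts f d = iso_verts f b" "c \<in> X" "d \<in> X"
      using e arc[of c d] by auto
    then have "c = a" "d = b"
      using inj ab by (auto dest: inj_onD)
    then show "(a, b) \<in> parcs \<Gamma>"
      using e(1) cd by simp
  qed
qed

section \<open>Levels, descendants and isomorphisms for a bare edge relation\<close>

locale levelled_relation =
  fixes E :: "'a rel" and \<alpha> :: 'a
  assumes level_unique: "(\<alpha>, x) \<in> E ^^ i \<Longrightarrow> (\<alpha>, x) \<in> E ^^ j \<Longrightarrow> i = j"
begin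

definition D :: "'a \<Rightarrow> 'a set" where
  "D u = E\<^sup>* `` {u}"

definition L :: "nat \<Rightarrow> 'a set" where
  "L i = {x. (\<alpha>, x) \<in> E ^^ i}"

text \<open>The ancestors of \<open>x\<close> within one level: the only form in which ancestors
  enter G3 and the relation \<rho>.\<close>

definition A :: "nat \<Rightarrow> 'a \<Rightarrow> 'a set" where
  "A i x = {y \<in> L i. x \<in> D y}"

text \<open>A common format for P1 and P2: an isomorphism from \<Gamma>(u) onto \<Gamma>, given on
  vertices, with automorphisms as the case \<open>u = \<alpha>\<close>. Values outside
  \<open>D u\<close> are arbitrary.\<close>

definition desc_iso :: "'a \<Rightarrow> ('a \<Rightarrow> 'a) \<Rightarrow> bool" where
  "desc_iso u \<phi> \<longleftrightarrow> bij_betw \<phi> (D u) (D \<alpha>) \<and>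
     (\<forall>a\<in>D u. \<forall>b\<in>D u. (a, b) \<in> E \<longleftrightarrow> (\<phi> a, \<phi> b) \<in> E)"

lemma L_unique: "x \<in> L i \<Longrightarrow> x \<in> L j \<Longrightarrow> i = j"
  using level_unique by (auto simp: L_def)

lemma L_0: "L 0 = {\<alpha>}"
  by (auto simp: L_def)

lemma L_relpow: "x \<in> L i \<Longrightarrow> (x, y) \<in> E ^^ n \<Longrightarrow> y \<in> L (i + n)"
  by (auto simp: L_def relpow_add)

lemma L_edge: "x \<in> L i \<Longrightarrow> (x, y) \<in> E \<Longrightarrow> y \<in> L (Suc i)"
  using L_relpow[of x i y 1] by simp

lemma L_Suc: "L (Suc i) = E `` L i"
  by (auto simp: L_def)

lemma L_SucE:
  assumes "y \<in> L (Suc i)"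
  obtains x where "x \<in> L i" "(x, y) \<in> E"
  using assms by (auto simp: L_Suc)

lemma D_self [simp]: "x \<in> D x"
  by (simp add: D_def)

lemma D_trans: "x \<in> D y \<Longrightarrow> y \<in> D z \<Longrightarrow> x \<in> D z"
  by (auto simp: D_def)

lemma D_edge: "x \<in> D u \<Longrightarrow> (x, y) \<in> E \<Longrightarrow> y \<in> D u"
  by (auto simp: D_def)

lemma D_relpow: "x \<in> D u \<Longrightarrow> (x, y) \<in> E ^^ n \<Longrightarrow> y \<in> D u"
  by (auto simp: D_def dest: relpow_imp_rtrancl)

lemma D_iff_relpow: "y \<in> D x \<longleftrightarrow> (\<exists>n. (x, y) \<in> E ^^ n)"
  by (auto simp: D_def rtrancl_is_UN_relpow)

lemma D_root: "D \<alpha> = (\<Union>i. L i)"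
  by (auto simp: D_iff_relpow L_def)

lemma L_subset_D_root: "x \<in> L i \<Longrightarrow> x \<in> D \<alpha>"
  by (auto simp: D_root)

text \<open>A walk of length \<open>n\<close> from level \<open>i\<close> ends in level
  \<open>i + n\<close>; as levels are unique, the length is forced.\<close>

lemma D_level_relpow:
  assumes "x \<in> L i" "y \<in> D x" "y \<in> L j"
  shows "i \<le> j" "(x, y) \<in> E ^^ (j - i)"
proof -
  obtain n where n: "(x, y) \<in> E ^^ n"
    using assms(2) by (auto simp: D_iff_relpow)
  then have "j = i + n"
    using L_relpow[OF assms(1) n] L_unique assms(3) by blast
  then show "i \<le> j" "(x, y) \<in> E ^^ (j - i)"
    using n by auto
qed

text \<open>Each edge of a walk goes down exactly one level, so a walk from \<open>x\<close> to
  \<open>y\<close> meets every level in between.\<close>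

lemma D_interpolate:
  assumes "x \<in> L i" "y \<in> D x" "y \<in> L j" "i \<le> n" "n \<le> j"
  obtains z where "z \<in> L n" "z \<in> D x" "y \<in> D z"
proof -
  have "(x, y) \<in> E ^^ ((n - i) + (j - n))"
    using D_level_relpow[OF assms(1-3)] assms(4,5) by simp
  then obtain z where z: "(x, z) \<in> E ^^ (n - i)" "(z, y) \<in> E ^^ (j - n)"
    by (auto simp: relpow_add)
  then show thesis
    using that[of z] L_relpow[OF assms(1) z(1)] assms(4) by (auto simp: D_iff_relpow)
qed

lemma A_mono: "z \<in> D x \<Longrightarrow> A i x \<subseteq> A i z"
  by (auto simp: A_def intro: D_trans)

lemma desc_iso_inj: "desc_iso u \<phi> \<Longrightarrow> inj_on \<phi> (D u)"
  by (auto simp: desc_iso_def bij_betw_def)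

lemma desc_iso_image: "desc_iso u \<phi> \<Longrightarrow> \<phi> ` D u = D \<alpha>"
  by (auto simp: desc_iso_def bij_betw_def)

text \<open>Walks that start in \<open>D u\<close> stay there, so edges can be transported one at a
  time. Backwards, the intermediate vertex lies in \<open>D \<alpha>\<close> and is pulled back
  along \<open>\<phi>\<close>.\<close>

lemma desc_iso_relpow:
  assumes "desc_iso u \<phi>" "a \<in> D u" "b \<in> D u"
  shows "(a, b) \<in> E ^^ n \<longleftrightarrow> (\<phi> a, \<phi> b) \<in> E ^^ n"
  using assms(3)
proof (induction n arbitrary: b)
  case 0
  then show ?case
    using inj_on_eq_iff[OF desc_iso_inj[OF assms(1)] assms(2)] by simp
next
  case (Suc n)
  show ?case
  proof
    assume "(a, b) \<in> E ^^ Suc n"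
    then obtain c where c: "(a, c) \<in> E ^^ n" "(c, b) \<in> E"
      by auto
    have "c \<in> D u"
      using D_relpow[OF assms(2) c(1)] .
    then show "(\<phi> a, \<phi> b) \<in> E ^^ Suc n"
      using c Suc assms(1) by (auto simp: desc_iso_def)
  next
    assume "(\<phi> a, \<phi> b) \<in> E ^^ Suc n"
    then obtain c' where c': "(\<phi> a, c') \<in> E ^^ n" "(c', \<phi> b) \<in> E"
      by auto
    have "\<phi> a \<in> D \<alpha>"
      using desc_iso_image[OF assms(1)] assms(2) by blast
    then have "c' \<in> D \<alpha>"
      using c'(1) by (rule D_relpow)
    then obtain c where c: "c \<in> D u" "c' = \<phi> c"
      using desc_iso_image[OF assms(1)] by blast
    then have "(a, c) \<in> E ^^ n" "(c, b) \<in> E"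
      using c' Suc assms(1) by (auto simp: desc_iso_def)
    then show "(a, b) \<in> E ^^ Suc n"
      by auto
  qed
qed

lemma desc_iso_D_iff:
  assumes "desc_iso u \<phi>" "a \<in> D u" "b \<in> D u"
  shows "b \<in> D a \<longleftrightarrow> \<phi> b \<in> D (\<phi> a)"
  using desc_iso_relpow[OF assms] by (simp add: D_iff_relpow)

text \<open>The preimage of \<open>\<alpha>\<close> descends from \<open>u\<close>, hence
  \<open>\<alpha>\<close> descends from \<open>\<phi> u\<close>. Walks never lead to a smaller
  level, so \<open>\<phi> u\<close> has level 0.\<close>

lemma desc_iso_root:
  assumes "desc_iso u \<phi>"
  shows "\<phi> u = \<alpha>"
proof -
  have "\<alpha> \<in> \<phi> ` D u"
    using desc_iso_image[OF assms] by simp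
  then obtain v where v: "v \<in> D u" "\<phi> v = \<alpha>"
    by blast
  have "\<phi> u \<in> D \<alpha>"
    using desc_iso_image[OF assms] imageI[OF D_self[of u], of \<phi>] by simp
  then obtain i where i: "\<phi> u \<in> L i"
    by (auto simp: D_root)
  have "\<alpha> \<in> D (\<phi> u)"
    using desc_iso_D_iff[OF assms D_self v(1)] v by simp
  then have "i \<le> 0"
    using D_level_relpow(1)[OF i, of \<alpha> 0] by (simp add: L_0)
  then show ?thesis
    using i by (simp add: L_0)
qed

text \<open>The level of a descendant of \<open>u\<close> is \<open>d\<close> plus the length of a
  walk from \<open>u\<close>, and \<open>\<phi>\<close> turns this into a walk of the same length
  from \<open>\<alpha>\<close>. Thus \<open>\<phi>\<close> lowers levels by
  \<open>d\<close>.\<close>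

lemma desc_iso_level_iff:
  assumes "desc_iso u \<phi>" "u \<in> L d" "x \<in> D u"
  shows "x \<in> L (d + i) \<longleftrightarrow> \<phi> x \<in> L i"
proof -
  have "x \<in> L (d + i) \<longleftrightarrow> (u, x) \<in> E ^^ i"
    using D_level_relpow(2)[OF assms(2,3)] L_relpow[OF assms(2)] by fastforce
  also have "\<dots> \<longleftrightarrow> \<phi> x \<in> L i"
    using desc_iso_relpow[OF assms(1) D_self assms(3)] desc_iso_root[OF assms(1)]
    by (simp add: L_def)
  finally show ?thesis .
qed

lemma desc_iso_image_D:
  assumes "desc_iso u \<phi>" "a \<in> D u"
  shows "\<phi> ` D a = D (\<phi> a)"
proof
  show "\<phi> ` D a \<subseteq> D (\<phi> a)"
    using desc_iso_D_iff[OF assms] D_trans[OF _ assms(2)] by blast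
  show "D (\<phi> a) \<subseteq> \<phi> ` D a"
  proof
    fix c assume c: "c \<in> D (\<phi> a)"
    have "\<phi> a \<in> D \<alpha>"
      using desc_iso_image[OF assms(1)] assms(2) by blast
    then have "c \<in> \<phi> ` D u"
      using D_trans[OF c] desc_iso_image[OF assms(1)] by simp
    then show "c \<in> \<phi> ` D a"
      using desc_iso_D_iff[OF assms] c by blast
  qed
qed

lemma desc_iso_image_succ:
  assumes "desc_iso u \<phi>" "S \<subseteq> D u"
  shows "\<phi> ` (E `` S) = E `` (\<phi> ` S)"
proof
  show "\<phi> ` (E `` S) \<subseteq> E `` (\<phi> ` S)"
  proof
    fix y assume "y \<in> \<phi> ` (E `` S)"
    then obtain a b where ab: "a \<in> S" "(a, b) \<in> E" "y = \<phi> b" by blast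
    then have "a \<in> D u" "b \<in> D u"
      using assms(2) D_edge by blast+
    then show "y \<in> E `` (\<phi> ` S)"
      using ab assms(1) by (auto simp: desc_iso_def)
  qed
  show "E `` (\<phi> ` S) \<subseteq> \<phi> ` (E `` S)"
  proof
    fix y assume "y \<in> E `` (\<phi> ` S)"
    then obtain a where a: "a \<in> S" "(\<phi> a, y) \<in> E" by blast
    then have aD: "a \<in> D u"
      using assms(2) by blast
    then have "\<phi> a \<in> D \<alpha>"
      using desc_iso_image[OF assms(1)] by blast
    then have "y \<in> \<phi> ` D u"
      using D_edge[OF _ a(2)] desc_iso_image[OF assms(1)] by simp
    then obtain b where "b \<in> D u" "y = \<phi> b" by blast
    then show "y \<in> \<phi> ` (E `` S)"
      using a aD assms(1) by (auto simp: desc_iso_def)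
  qed
qed

lemma desc_iso_comp:
  assumes "desc_iso u \<phi>" "desc_iso \<alpha> \<psi>"
  shows "desc_iso u (\<psi> \<circ> \<phi>)"
proof -
  have "\<phi> a \<in> D \<alpha>" if "a \<in> D u" for a
    using that desc_iso_image[OF assms(1)] by blast
  then show ?thesis
    using assms bij_betw_trans[of \<phi> "D u" "D \<alpha>" \<psi> "D \<alpha>"] by (auto simp: desc_iso_def)
qed

end

section \<open>Finite levels and stabilisation of the first-level ancestors\<close>

locale homogeneous_levelled_relation = levelled_relation +
  assumes finite_succ: "x \<in> D \<alpha> \<Longrightarrow> finite (E `` {x})"
    and succ_nonempty: "x \<in> D \<alpha> \<Longrightarrow> \<exists>y. (x, y) \<in> E"
    and ex_desc_iso: "u \<in> D \<alpha> \<Longrightarrow> \<exists>\<phi>. desc_iso u \<phi>"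
    and level_transitive: "x \<in> L i \<Longrightarrow> y \<in> L i \<Longrightarrow> \<exists>\<phi>. desc_iso \<alpha> \<phi> \<and> \<phi> x = y"
begin

lemma finite_L: "finite (L i)"
proof (induction i)
  case (Suc i)
  have "L (Suc i) = (\<Union>x\<in>L i. E `` {x})"
    by (auto simp: L_Suc)
  then show ?case
    using Suc finite_succ L_subset_D_root by auto
qed (simp add: L_0)

lemma L_nonempty: "L i \<noteq> {}"
proof (induction i)
  case (Suc i)
  then show ?case
    using succ_nonempty L_subset_D_root by (force simp: L_Suc)
qed (simp add: L_0)

lemma finite_A: "finite (A i x)"
  by (rule finite_subset[OF _ finite_L[of i]]) (auto simp: A_def)

text \<open>An automorphism taking \<open>x\<close> to \<open>y\<close> preserves levels and
  descendants, so it maps \<open>A i x\<close> bijectively onto \<open>A i y\<close>.\<close>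

lemma card_A_level:
  assumes "x \<in> L l" "y \<in> L l"
  shows "card (A i x) = card (A i y)"
proof -
  obtain \<phi> where \<phi>: "desc_iso \<alpha> \<phi>" "\<phi> x = y"
    using level_transitive[OF assms] by blast
  have xD: "x \<in> D \<alpha>"
    using assms(1) by (rule L_subset_D_root)
  have root: "\<alpha> \<in> L 0"
    by (simp add: L_0)
  have "\<phi> ` A i x = A i y"
  proof
    show "\<phi> ` A i x \<subseteq> A i y"
    proof
      fix c assume "c \<in> \<phi> ` A i x"
      then obtain b where b: "b \<in> A i x" "c = \<phi> b" by blast
      then have bD: "b \<in> D \<alpha>"
        by (auto simp: A_def intro: L_subset_D_root)
      show "c \<in> A i y"
        using b desc_iso_level_iff[OF \<phi>(1) root bD, of i] desc_iso_D_iff[OF \<phi>(1) bD xD] \<phi>(2)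
        by (auto simp: A_def)
    qed
    show "A i y \<subseteq> \<phi> ` A i x"
    proof
      fix c assume c: "c \<in> A i y"
      then have "c \<in> D \<alpha>"
        by (auto simp: A_def intro: L_subset_D_root)
      then obtain b where b: "b \<in> D \<alpha>" "c = \<phi> b"
        using desc_iso_image[OF \<phi>(1)] by blast
      then have "b \<in> A i x"
        using c desc_iso_level_iff[OF \<phi>(1) root b(1), of i] desc_iso_D_iff[OF \<phi>(1) b(1) xD] \<phi>(2)
        by (auto simp: A_def)
      then show "c \<in> \<phi> ` A i x"
        using b by blast
    qed
  qed
  moreover have "inj_on \<phi> (A i x)"
    using desc_iso_inj[OF \<phi>(1)] by (rule inj_on_subset) (auto simp: A_def intro: L_subset_D_root)
  ultimately show ?thesis
    using card_image by metis
qed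

text \<open>The number of ancestors in the first level depends only on the level, by transitivity;
  it grows with the level and is bounded, so from some level on no new ancestors can appear.\<close>

lemma ex_stable_level:
  "\<exists>k\<ge>1. \<forall>l\<ge>k. \<forall>x\<in>L l. \<forall>z\<in>D x. A 1 z = A 1 x"
proof -
  \<comment> \<open>By \<open>card_A_level\<close> the value does not depend on the chosen vertex of
    the level.\<close>
  define f where "f l = card (A 1 (SOME x. x \<in> L l))" for l
  have f: "card (A 1 x) = f l" if "x \<in> L l" for x l
    unfolding f_def using card_A_level[OF that] someI[of "\<lambda>x. x \<in> L l" x] that by blast
  have bound: "f l \<le> card (L 1)" for l
    unfolding f_def by (rule card_mono[OF finite_L]) (auto simp: A_def)
  obtain k where k: "\<And>l. f l \<le> f k"
  proof -
    have "finite (range f)"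
      using bound finite_nat_set_iff_bounded_le by blast
    then have "Max (range f) \<in> range f" "\<And>l. f l \<le> Max (range f)"
      by (simp_all add: Max_in)
    then show thesis
      using that by (metis imageE)
  qed
  have mono: "f i \<le> f j" if "i \<le> j" for i j
  proof (rule lift_Suc_mono_le[OF _ that])
    fix n
    obtain x where x: "x \<in> L n"
      using L_nonempty by blast
    then obtain y where y: "(x, y) \<in> E"
      using succ_nonempty L_subset_D_root by blast
    then have "card (A 1 x) \<le> card (A 1 y)"
      by (intro card_mono finite_A A_mono D_edge[OF D_self])
    then show "f n \<le> f (Suc n)"
      using f[OF x] f[OF L_edge[OF x y]] by simp
  qed
  \<comment> \<open>From level \<open>k\<close> on, \<open>f\<close> equals its maximum, so
    inclusion of finite sets becomes equality. The shift to \<open>Suc k\<close> secures the bound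
    \<open>\<ge> 1\<close>.\<close>
  have "A 1 z = A 1 x" if l: "l \<ge> Suc k" and x: "x \<in> L l" and z: "z \<in> D x" for l x z
  proof -
    obtain n where "z \<in> L (l + n)"
      using z L_relpow[OF x] by (auto simp: D_iff_relpow)
    then have "card (A 1 z) = f (l + n)"
      by (rule f)
    also have "\<dots> \<le> f l"
      using k[of "l + n"] mono[of k l] l by simp
    also have "\<dots> = card (A 1 x)"
      using f[OF x] by simp
    finally show ?thesis
      using card_seteq[OF finite_A A_mono[OF z]] by metis
  qed
  moreover have "Suc k \<ge> 1"
    by simp
  ultimately show ?thesis
    by blast
qed

end

section \<open>Stable ancestors and the class relation\<close>

locale stable_levelled_relation = homogeneous_levelled_relation +
  fixes k :: nat
  assumes k_pos: "k \<ge> 1"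
    and stable: "l \<ge> k \<Longrightarrow> x \<in> L l \<Longrightarrow> z \<in> D x \<Longrightarrow> A 1 z = A 1 x"
begin

definition R :: "'a rel" where
  "R = {(x, y). \<exists>l\<ge>k. x \<in> L l \<and> y \<in> L l \<and> A (l - k + 1) x = A (l - k + 1) y}"

definition cls :: "'a \<Rightarrow> 'a set" where
  "cls x = R `` {x}"

definition classes :: "'a set set" where
  "classes = (\<Union>l\<in>{k..}. L l) // R"

definition Desc :: "'a set \<Rightarrow> 'a set" where
  "Desc S = (\<Union>x\<in>S. D x)"

text \<open>For a class \<open>S\<close> these are its out-neighbours in the quotient, written as an
  image so that finiteness and transport along isomorphisms are easy to see.\<close>

definition child_classes :: "'a set \<Rightarrow> 'a set set" where
  "child_classes S = cls ` (E `` S)"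

text \<open>This is G3 with \<open>u\<close> in place of the root. An isomorphism from \<Gamma>(u)
  onto \<Gamma> sends \<open>v\<close> to level 1 and \<open>x\<close> to level
  \<open>n \<ge> k\<close>, where \<open>stable\<close> applies.\<close>

lemma stable_at:
  assumes "u \<in> L d" "x \<in> L (d + n)" "x \<in> D u" "n \<ge> k" "z \<in> D x"
    and v: "(u, v) \<in> E" "z \<in> D v"
  shows "x \<in> D v"
proof -
  obtain \<phi> where \<phi>: "desc_iso u \<phi>"
    using ex_desc_iso L_subset_D_root assms(1) by blast
  have vD: "v \<in> D u" and zD: "z \<in> D u"
    using D_edge[OF D_self v(1)] D_trans[OF assms(5,3)] by auto
  have "v \<in> L (d + 1)"
    using L_edge[OF assms(1) v(1)] by simp
  then have "\<phi> v \<in> L 1"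
    using desc_iso_level_iff[OF \<phi> assms(1) vD] by blast
  moreover have "\<phi> z \<in> D (\<phi> v)"
    using desc_iso_D_iff[OF \<phi> vD zD] v(2) by blast
  ultimately have "\<phi> v \<in> A 1 (\<phi> z)"
    by (simp add: A_def)
  moreover have "\<phi> x \<in> L n" "\<phi> z \<in> D (\<phi> x)"
    using desc_iso_level_iff[OF \<phi> assms(1,3)] desc_iso_D_iff[OF \<phi> assms(3) zD] assms by auto
  ultimately have "\<phi> v \<in> A 1 (\<phi> x)"
    using stable[OF assms(4)] by blast
  then show ?thesis
    using desc_iso_D_iff[OF \<phi> vD assms(3)] by (simp add: A_def)
qed

text \<open>Induction on \<open>i\<close>: an ancestor \<open>v\<close> of \<open>z\<close> in level
  \<open>Suc i\<close> has a parent \<open>u\<close> in level \<open>i\<close>, which is an ancestor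
  of \<open>x\<close> by induction. The bound keeps \<open>x\<close> at least \<open>k\<close>
  levels below \<open>u\<close>, so \<open>stable_at\<close> shows that \<open>v\<close> is an
  ancestor of \<open>x\<close> too.\<close>

lemma stable_ancestors:
  assumes "x \<in> L l" "z \<in> D x" "i + k \<le> l + 1"
  shows "A i z = A i x"
proof
  show "A i x \<subseteq> A i z"
    using assms(2) by (rule A_mono)
  show "A i z \<subseteq> A i x"
    using assms(3)
  proof (induction i)
    case 0
    then show ?case
      using L_subset_D_root[OF assms(1)] by (auto simp: A_def L_0)
  next
    case (Suc i)
    show ?case
    proof
      fix v assume "v \<in> A (Suc i) z"
      then have v: "v \<in> L (Suc i)" "z \<in> D v"
        by (auto simp: A_def)
      obtain u where u: "u \<in> L i" "(u, v) \<in> E"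
        using v(1) by (rule L_SucE)
      then have "u \<in> A i z"
        using v(2) D_trans[OF _ D_edge[OF D_self u(2)]] by (auto simp: A_def)
      then have "u \<in> A i x"
        using Suc by auto
      then have "x \<in> D u"
        by (simp add: A_def)
      then have "x \<in> D v"
        using stable_at[OF u(1) _ _ _ assms(2) u(2) v(2), of "l - i"] assms(1) Suc.prems by simp
      then show "v \<in> A (Suc i) x"
        using v(1) by (simp add: A_def)
    qed
  qed
qed

lemma R_iff:
  assumes "x \<in> L l" "l \<ge> k"
  shows "(x, y) \<in> R \<longleftrightarrow> y \<in> L l \<and> A (l - k + 1) x = A (l - k + 1) y"
proof
  assume "(x, y) \<in> R"
  then obtain i where i: "i \<ge> k" "x \<in> L i" "y \<in> L i" "A (i - k + 1) x = A (i - k + 1) y"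
    unfolding R_def by blast
  have "i = l"
    using L_unique[OF i(2) assms(1)] .
  then show "y \<in> L l \<and> A (l - k + 1) x = A (l - k + 1) y"
    using i by simp
next
  assume "y \<in> L l \<and> A (l - k + 1) x = A (l - k + 1) y"
  then show "(x, y) \<in> R"
    using assms unfolding R_def by blast
qed

lemma equiv_R: "equiv (\<Union>l\<in>{k..}. L l) R"
proof (rule equivI)
  show "R \<subseteq> (\<Union>l\<in>{k..}. L l) \<times> (\<Union>l\<in>{k..}. L l)"
    by (auto simp: R_def)
  show "refl_on (\<Union>l\<in>{k..}. L l) R"
    by (auto simp: refl_on_def R_def)
  show "sym R"
    by (auto simp: sym_def R_def)
  show "trans R"
  proof (rule transI)
    fix x y z assume "(x, y) \<in> R" "(y, z) \<in> R"
    then obtain l where "l \<ge> k" "x \<in> L l" "y \<in> L l" "(x, y) \<in> R" "(y, z) \<in> R"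
      by (auto simp: R_def)
    then show "(x, z) \<in> R"
      using R_iff by simp
  qed
qed

lemma cls_iff:
  assumes "x \<in> L l" "l \<ge> k"
  shows "y \<in> cls x \<longleftrightarrow> y \<in> L l \<and> A (l - k + 1) x = A (l - k + 1) y"
  using R_iff[OF assms] by (simp add: cls_def)

lemma cls_self: "x \<in> L l \<Longrightarrow> l \<ge> k \<Longrightarrow> x \<in> cls x"
  using cls_iff by blast

lemma cls_subset_L: "x \<in> L l \<Longrightarrow> l \<ge> k \<Longrightarrow> cls x \<subseteq> L l"
  using cls_iff by blast

lemma cls_eqI: "x \<in> L l \<Longrightarrow> l \<ge> k \<Longrightarrow> y \<in> cls x \<Longrightarrow> cls y = cls x"
  using equiv_class_eq[OF equiv_R, of x y] by (simp add: cls_def)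

lemma classesE:
  assumes "C \<in> classes"
  obtains x l where "l \<ge> k" "x \<in> L l" "C = cls x"
  using assms unfolding classes_def cls_def by (elim quotientE UN_E) auto

lemma cls_in_classes: "x \<in> L l \<Longrightarrow> l \<ge> k \<Longrightarrow> cls x \<in> classes"
  unfolding classes_def cls_def by (rule quotientI) auto

lemma class_member:
  assumes "C \<in> classes" "y \<in> C"
  obtains l where "l \<ge> k" "y \<in> L l" "C = cls y" "C \<subseteq> L l"
proof -
  obtain x l where x: "l \<ge> k" "x \<in> L l" "C = cls x"
    using assms(1) by (rule classesE)
  then show thesis
    using that[of l] cls_eqI cls_subset_L assms(2) by blast
qed

lemma class_nonempty:
  assumes "C \<in> classes"
  shows "C \<noteq> {}"
proof -
  obtain x l where "l \<ge> k" "x \<in> L l" "C = cls x"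
    using assms by (rule classesE)
  then show ?thesis
    using cls_self[of x l] by auto
qed

text \<open>The level \<open>l - k + 1\<close> in the definition of \<open>R\<close> is the last one
  for which \<open>stable_ancestors\<close> applies to vertices of level \<open>l\<close>. There
  \<open>z\<close> has exactly the ancestors of \<open>x\<close> and exactly those of
  \<open>y\<close>.\<close>

lemma common_descendant_cls:
  assumes "x \<in> L l" "y \<in> L l" "l \<ge> k" "z \<in> D x" "z \<in> D y"
  shows "cls x = cls y"
proof -
  have i: "l - k + 1 + k \<le> l + 1"
    using assms(3) by simp
  have "A (l - k + 1) x = A (l - k + 1) y"
    using stable_ancestors[OF assms(1,4) i] stable_ancestors[OF assms(2,5) i] by (rule subst)
  then have "y \<in> cls x"
    using assms(2) cls_iff[OF assms(1,3), of y] by simp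
  then show ?thesis
    using cls_eqI[OF assms(1,3)] by simp
qed

text \<open>Related vertices of level \<open>j\<close> share their ancestors in level
  \<open>j - k + 1\<close>, hence also in the smaller level \<open>l - k + 1\<close>, where by
  stability these are the ancestors of \<open>x\<close> and of \<open>x'\<close>. So a class has at
  most one ancestor class in each level from \<open>k\<close> on.\<close>

lemma ancestor_cls_eq:
  assumes "z \<in> cls z'" "z' \<in> L j" "x \<in> L l" "z \<in> D x" "x' \<in> L l" "z' \<in> D x'" "l \<ge> k"
  shows "cls x = cls x'"
proof -
  have lj: "l \<le> j"
    using assms cls_subset_L D_level_relpow(1)[OF assms(5,6,2)] by simp
  then have z: "z \<in> L j" "A (j - k + 1) z = A (j - k + 1) z'"
    using assms(1,7) cls_iff[OF assms(2), of z] by auto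
  \<comment> \<open>Equality of the ancestors in one level passes down to every lower level.\<close>
  have down: "A i a \<subseteq> A i b"
    if a: "a \<in> L j" and eq: "A (j - k + 1) a = A (j - k + 1) b" and i: "i \<le> j - k + 1" for i a b
  proof
    fix u assume "u \<in> A i a"
    then have u: "u \<in> L i" "a \<in> D u"
      by (auto simp: A_def)
    obtain v where v: "v \<in> L (j - k + 1)" "v \<in> D u" "a \<in> D v"
      by (rule D_interpolate[OF u a, of "j - k + 1"]) (use i lj assms(7) k_pos in auto)
    then have "v \<in> A (j - k + 1) b"
      using eq by (auto simp: A_def)
    then show "u \<in> A i b"
      using u(1) D_trans[OF _ v(2), of b] by (simp add: A_def)
  qed
  have "A (l - k + 1) z = A (l - k + 1) z'"
    using down[OF z, of "l - k + 1"] down[OF assms(2) z(2)[symmetric], of "l - k + 1"] lj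
    by (intro equalityI) simp_all
  moreover have i: "l - k + 1 + k \<le> l + 1"
    using assms(7) by simp
  ultimately have "A (l - k + 1) x = A (l - k + 1) x'"
    using stable_ancestors[OF assms(3,4) i] stable_ancestors[OF assms(5,6) i] by metis
  then have "x' \<in> cls x"
    using assms(5) cls_iff[OF assms(3,7), of x'] by simp
  then show ?thesis
    using cls_eqI[OF assms(3,7)] by simp
qed

text \<open>Everything descends from \<open>\<alpha>\<close>, so another member \<open>z'\<close> of
  \<open>B\<close> has some ancestor in the level of \<open>C\<close>; by
  \<open>ancestor_cls_eq\<close> this ancestor lies in \<open>C\<close>.\<close>

lemma Desc_class_union:
  assumes C: "C \<in> classes" and B: "B \<in> classes" and z: "z \<in> B" "z \<in> Desc C"
  shows "B \<subseteq> Desc C"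
proof
  fix z' assume z': "z' \<in> B"
  obtain x where x: "x \<in> C" "z \<in> D x"
    using z(2) by (auto simp: Desc_def)
  obtain l where l: "l \<ge> k" "x \<in> L l" "C = cls x"
    using class_member[OF C x(1)] by blast
  obtain j where j: "j \<ge> k" "z \<in> L j" "B = cls z" "B \<subseteq> L j"
    using class_member[OF B z(1)] by blast
  have z'L: "z' \<in> L j" and zz': "z \<in> cls z'"
    using j z' z(1) cls_eqI[OF j(2,1), of z'] by auto
  have "l \<le> j"
    using D_level_relpow(1)[OF l(2) x(2) j(2)] .
  then obtain x' where x': "x' \<in> L l" "z' \<in> D x'"
    using D_interpolate[of \<alpha> 0 z' j l] z'L L_subset_D_root[OF z'L] L_0 by auto
  have "cls x = cls x'"
    using ancestor_cls_eq[OF zz' z'L l(2) x(2) x' l(1)] .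
  then have "x' \<in> C"
    using cls_self[OF x'(1) l(1)] l(3) by simp
  then show "z' \<in> Desc C"
    using x'(2) by (auto simp: Desc_def)
qed

text \<open>Since \<open>B\<close> lies in a single level, \<open>a\<close> and \<open>a'\<close>
  both lie in the preceding one and \<open>ancestor_cls_eq\<close> applies. This bounds the
  in-degree in the quotients by one.\<close>

lemma parent_cls_unique:
  assumes "C \<in> classes" "C' \<in> classes" "B \<in> classes"
    and "a \<in> C" "b \<in> B" "(a, b) \<in> E" "a' \<in> C'" "b' \<in> B" "(a', b') \<in> E"
  shows "C = C'"
proof -
  obtain l where l: "l \<ge> k" "a \<in> L l" "C = cls a"
    using class_member[OF assms(1,4)] by blast
  obtain l' where l': "l' \<ge> k" "a' \<in> L l'" "C' = cls a'"
    using class_member[OF assms(2,7)] by blast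
  obtain j where j: "j \<ge> k" "b \<in> L j" "B = cls b" "B \<subseteq> L j"
    using class_member[OF assms(3,5)] by blast
  have "Suc l = Suc l'"
    using L_unique[OF L_edge[OF l(2) assms(6)]] L_unique[OF L_edge[OF l'(2) assms(9)]] j assms(8)
    by auto
  then have a': "a' \<in> L l"
    using l'(2) by simp
  have b': "b' \<in> L j" "b \<in> cls b'"
    using j assms(5,8) cls_eqI[OF j(2,1), of b'] by auto
  show ?thesis
    using ancestor_cls_eq[OF b'(2,1) l(2) D_edge[OF D_self assms(6)] a' D_edge[OF D_self assms(9)] l(1)]
      l(3) l'(3) by simp
qed

text \<open>The class of \<open>x\<close> is decided by ancestors in level
  \<open>n = l - k + 1\<close>. The bound on \<open>l\<close> gives \<open>n \<ge> d + k\<close>, so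
  vertices of level \<open>n\<close> have the same ancestors in level \<open>d\<close> as their
  descendants. Hence all deciding ancestors lie in \<open>D u\<close>, where \<open>\<phi>\<close>
  can transport them.\<close>

lemma desc_iso_cls:
  assumes \<phi>: "desc_iso u \<phi>" "u \<in> L d" and x: "x \<in> L l" "x \<in> D u"
    and l: "l \<ge> 2 * k - 1 + d"
  shows "cls x \<subseteq> D u" "\<phi> ` cls x = cls (\<phi> x)"
proof -
  define n where "n = l - k + 1"
  \<comment> \<open>In particular \<open>n - d\<close> is the level that decides the class of
    \<open>\<phi> x\<close>, which has level \<open>l - d\<close>.\<close>
  have n: "n + k = l + 1" "d + k \<le> n + 1" "d \<le> n" "n \<le> l" "l \<ge> k" "l - d \<ge> k"
    "l - d - k + 1 = n - d" "d + (l - d) = l" "d + (n - d) = n"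
    using l k_pos by (auto simp: n_def)
  show sub: "cls x \<subseteq> D u"
  proof
    fix y assume "y \<in> cls x"
    then have "A n x = A n y"
      using cls_iff[OF x(1) n(5)] by (simp add: n_def)
    \<comment> \<open>A vertex between \<open>u\<close> and \<open>x\<close> in level
      \<open>n\<close> is shared with \<open>y\<close> and so puts \<open>y\<close> below
      \<open>u\<close>.\<close>
    moreover obtain z where "z \<in> L n" "z \<in> D u" "x \<in> D z"
      using D_interpolate[OF \<phi>(2) x(2,1) n(3,4)] .
    ultimately show "y \<in> D u"
      using D_trans by (auto simp: A_def)
  qed
  \<comment> \<open>An ancestor of \<open>y\<close> in level \<open>n\<close> is high enough to have the same ancestors in
    level \<open>d\<close> as \<open>y\<close> itself.\<close>
  have A_sub: "A n y \<subseteq> D u" if "y \<in> L l" "y \<in> D u" for y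
  proof
    fix z assume "z \<in> A n y"
    then have z: "z \<in> L n" "y \<in> D z"
      by (auto simp: A_def)
    have "u \<in> A d y"
      using \<phi>(2) that by (simp add: A_def)
    then have "u \<in> A d z"
      using stable_ancestors[OF z n(2)] by simp
    then show "z \<in> D u"
      by (simp add: A_def)
  qed
  have A_img: "\<phi> ` A n y = A (n - d) (\<phi> y)" if y: "y \<in> L l" "y \<in> D u" for y
  proof
    show "\<phi> ` A n y \<subseteq> A (n - d) (\<phi> y)"
    proof
      fix c assume "c \<in> \<phi> ` A n y"
      then obtain b where b: "b \<in> A n y" "c = \<phi> b" by blast
      then have bD: "b \<in> D u"
        using A_sub[OF y] by blast
      show "c \<in> A (n - d) (\<phi> y)"
        using b desc_iso_level_iff[OF \<phi> bD, of "n - d"] desc_iso_D_iff[OF \<phi>(1) bD y(2)] n(9)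
        by (simp add: A_def)
    qed
    show "A (n - d) (\<phi> y) \<subseteq> \<phi> ` A n y"
    proof
      fix c assume c: "c \<in> A (n - d) (\<phi> y)"
      then have "c \<in> D \<alpha>"
        by (auto simp: A_def intro: L_subset_D_root)
      then obtain b where b: "b \<in> D u" "c = \<phi> b"
        using desc_iso_image[OF \<phi>(1)] by blast
      then have "b \<in> A n y"
        using c desc_iso_level_iff[OF \<phi> b(1), of "n - d"] desc_iso_D_iff[OF \<phi>(1) b(1) y(2)] n(9)
        by (simp add: A_def)
      then show "c \<in> \<phi> ` A n y"
        using b by blast
    qed
  qed
  have level: "\<phi> y \<in> L (l - d) \<longleftrightarrow> y \<in> L l" if "y \<in> D u" for y
    using desc_iso_level_iff[OF \<phi> that, of "l - d"] n(8) by simp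
  have mem: "y \<in> cls x \<longleftrightarrow> \<phi> y \<in> cls (\<phi> x)" if y: "y \<in> D u" for y
  proof (cases "y \<in> L l")
    case True
    have "A n x = A n y \<longleftrightarrow> A (n - d) (\<phi> x) = A (n - d) (\<phi> y)"
      using inj_on_image_eq_iff[OF desc_iso_inj[OF \<phi>(1)] A_sub[OF x] A_sub[OF True y]]
        A_img[OF x] A_img[OF True y] by simp
    then show ?thesis
      using cls_iff[OF x(1) n(5)] cls_iff[of "\<phi> x" "l - d"] level[OF y] level[OF x(2)] True x n
      by (simp add: n_def)
  next
    case False
    then show ?thesis
      using cls_iff[OF x(1) n(5)] cls_iff[of "\<phi> x" "l - d"] level[OF y] level[OF x(2)] x n
      by simp
  qed
  show "\<phi> ` cls x = cls (\<phi> x)"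
  proof
    show "\<phi> ` cls x \<subseteq> cls (\<phi> x)"
      using mem sub by blast
    show "cls (\<phi> x) \<subseteq> \<phi> ` cls x"
    proof
      fix c assume c: "c \<in> cls (\<phi> x)"
      then have "c \<in> D \<alpha>"
        using cls_subset_L[of "\<phi> x" "l - d"] level[OF x(2)] x(1) n(6) L_subset_D_root[of c "l - d"]
        by auto
      then obtain b where "b \<in> D u" "c = \<phi> b"
        using desc_iso_image[OF \<phi>(1)] by blast
      then show "c \<in> \<phi> ` cls x"
        using mem c by blast
    qed
  qed
qed

section \<open>All classes from level \<open>2 * k - 1\<close> on look alike\<close>

lemma ex_class_iso:
  assumes x: "x \<in> L l" "l \<ge> 2 * k - 1" and x0: "x0 \<in> L (2 * k - 1)"
  obtains u \<phi> d where "u \<in> L d" "l = 2 * k - 1 + d" "desc_iso u \<phi>" "x \<in> D u" "\<phi> x = x0"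
proof -
  \<comment> \<open>An isomorphism at an ancestor in level \<open>d\<close> moves \<open>x\<close>
    to level exactly \<open>2 * k - 1\<close>; an automorphism then moves it to
    \<open>x0\<close>.\<close>
  define d where "d = l - (2 * k - 1)"
  have d: "l = 2 * k - 1 + d" "l = d + (2 * k - 1)"
    using x(2) by (auto simp: d_def)
  obtain u where u: "u \<in> L d" "x \<in> D u"
    using D_interpolate[of \<alpha> 0 x l d] x(1) L_subset_D_root d L_0 by auto
  obtain \<phi> where \<phi>: "desc_iso u \<phi>"
    using ex_desc_iso L_subset_D_root u(1) by blast
  have "\<phi> x \<in> L (2 * k - 1)"
    using desc_iso_level_iff[OF \<phi> u] x(1) d(2) by blast
  then obtain \<psi> where "desc_iso \<alpha> \<psi>" "\<psi> (\<phi> x) = x0"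
    using level_transitive x0 by blast
  then show thesis
    using that[OF u(1) d(1), of "\<psi> \<circ> \<phi>"] desc_iso_comp[OF \<phi>] u(2) by simp
qed

text \<open>The map from \<open>ex_class_iso\<close> takes \<open>cls x\<close> onto
  \<open>cls x0\<close> and descendant sets to descendant sets, so it restricts to the required
  isomorphism.\<close>

lemma ex_Desc_iso:
  assumes x: "x \<in> L l" "l \<ge> 2 * k - 1" and x0: "x0 \<in> L (2 * k - 1)"
  obtains \<phi> where "bij_betw \<phi> (Desc (cls x)) (Desc (cls x0))"
    "\<And>a b. a \<in> Desc (cls x) \<Longrightarrow> b \<in> Desc (cls x) \<Longrightarrow> (a, b) \<in> E \<longleftrightarrow> (\<phi> a, \<phi> b) \<in> E"
proof -
  obtain u \<phi> d where u: "u \<in> L d" "l = 2 * k - 1 + d" "desc_iso u \<phi>" "x \<in> D u" "\<phi> x = x0"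
    using ex_class_iso[OF assms] .
  have c: "cls x \<subseteq> D u" "\<phi> ` cls x = cls x0"
    using desc_iso_cls[OF u(3,1) x(1) u(4)] u(2,5) by auto
  have sub: "Desc (cls x) \<subseteq> D u"
    using c(1) D_trans by (fastforce simp: Desc_def)
  have "\<phi> ` Desc (cls x) = (\<Union>y\<in>cls x. \<phi> ` D y)"
    by (auto simp: Desc_def)
  also have "\<dots> = (\<Union>y\<in>cls x. D (\<phi> y))"
    using desc_iso_image_D[OF u(3)] c(1) by (intro SUP_cong) auto
  also have "\<dots> = Desc (cls x0)"
    unfolding c(2)[symmetric] Desc_def by blast
  finally have "bij_betw \<phi> (Desc (cls x)) (Desc (cls x0))"
    using inj_on_subset[OF desc_iso_inj[OF u(3)] sub] by (simp add: bij_betw_def)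
  then show thesis
    using that[of \<phi>] u(3) sub by (auto simp: desc_iso_def)
qed

text \<open>Successors of \<open>cls x\<close> lie one level deeper, so \<open>desc_iso_cls\<close>
  applies to their classes with the same \<open>u\<close> and \<open>\<phi>\<close>. Taking images
  under \<open>\<phi>\<close> is then a bijection between the child classes.\<close>

lemma card_child_classes:
  assumes x: "x \<in> L l" "l \<ge> 2 * k - 1" and x0: "x0 \<in> L (2 * k - 1)"
  shows "card (child_classes (cls x)) = card (child_classes (cls x0))"
proof -
  obtain u \<phi> d where u: "u \<in> L d" "l = 2 * k - 1 + d" "desc_iso u \<phi>" "x \<in> D u" "\<phi> x = x0"
    using ex_class_iso[OF assms] .
  have c: "cls x \<subseteq> D u" "\<phi> ` cls x = cls x0"
    using desc_iso_cls[OF u(3,1) x(1) u(4)] u(2,5) by auto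
  have y: "cls y \<subseteq> D u" "\<phi> ` cls y = cls (\<phi> y)" if "y \<in> E `` cls x" for y
  proof -
    have yD: "y \<in> D u"
      using that c(1) D_edge by blast
    have yL: "y \<in> L (Suc l)"
      using that L_edge cls_subset_L[OF x(1)] x(2) k_pos by fastforce
    show "cls y \<subseteq> D u" "\<phi> ` cls y = cls (\<phi> y)"
      using desc_iso_cls[OF u(3,1) yL yD] u(2) by auto
  qed
  have "child_classes (cls x0) = cls ` \<phi> ` (E `` cls x)"
    using desc_iso_image_succ[OF u(3) c(1)] c(2) by (simp add: child_classes_def)
  also have "\<dots> = (\<lambda>S. \<phi> ` S) ` child_classes (cls x)"
    using y(2) by (auto simp: child_classes_def image_image intro!: image_cong)
  finally have "child_classes (cls x0) = (\<lambda>S. \<phi> ` S) ` child_classes (cls x)" .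
  moreover have "inj_on (\<lambda>S. \<phi> ` S) (child_classes (cls x))"
  proof (rule inj_on_subset[OF inj_on_image_Pow[OF desc_iso_inj[OF u(3)]]])
    show "child_classes (cls x) \<subseteq> Pow (D u)"
      using y(1) by (auto simp: child_classes_def)
  qed
  ultimately show ?thesis
    by (simp add: card_image)
qed

section \<open>The quotients as regular directed trees, and the partition into descendant
  sets\<close>

lemma child_classes_eq:
  assumes "C \<in> classes"
  shows "child_classes C = {B \<in> classes. \<exists>a\<in>C. \<exists>b\<in>B. (a, b) \<in> E}"
proof -
  obtain x l where x: "l \<ge> k" "x \<in> L l" "C = cls x"
    using assms by (rule classesE)
  have succ: "b \<in> L (Suc l)" if "a \<in> C" "(a, b) \<in> E" for a b
    using that(1) L_edge[OF _ that(2)] cls_subset_L[OF x(2,1)] x(3) by auto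
  have "cls b \<in> classes" "b \<in> cls b" if "a \<in> C" "(a, b) \<in> E" for a b
    using cls_in_classes[OF succ[OF that]] cls_self[OF succ[OF that]] x(1) by auto
  moreover have "B = cls b" if "B \<in> classes" "b \<in> B" for B b
    using class_member[OF that] by blast
  ultimately show ?thesis
    unfolding child_classes_def by blast
qed

lemma finite_child_classes:
  assumes "C \<in> classes"
  shows "finite (child_classes C)" "child_classes C \<noteq> {}"
proof -
  obtain x l where x: "l \<ge> k" "x \<in> L l" "C = cls x"
    using assms by (rule classesE)
  have "E `` C \<subseteq> L (Suc l)"
    using L_edge cls_subset_L[OF x(2,1)] x(3) by auto
  then show "finite (child_classes C)"
    using finite_subset[OF _ finite_L] by (simp add: child_classes_def)
  obtain y where "(x, y) \<in> E"
    using succ_nonempty L_subset_D_root x(2) by blast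
  then show "child_classes C \<noteq> {}"
    using cls_self[OF x(2,1)] x(3) by (auto simp: child_classes_def)
qed

text \<open>This is T(C)/\<rho> in terms of \<open>E\<close>. Both classes are contained in
  \<open>Desc C\<close>, so edges of \<open>E\<close> between them are edges of the induced
  subdigraph.\<close>

definition class_quotient :: "'a set \<Rightarrow> 'a set pair_pre_digraph" where
  "class_quotient C =
     \<lparr> pverts = {B \<in> classes. B \<subseteq> Desc C},
       parcs = {(A, B). A \<in> classes \<and> A \<subseteq> Desc C \<and> B \<in> classes \<and> B \<subseteq> Desc C \<and>
                  (\<exists>a\<in>A. \<exists>b\<in>B. (a, b) \<in> E)} \<rparr>"

lemma Desc_level:
  assumes "C \<subseteq> L l" "z \<in> Desc C"
  obtains j where "j \<ge> l" "z \<in> L j"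
proof -
  obtain x n where "x \<in> C" "(x, z) \<in> E ^^ n"
    using assms(2) by (auto simp: Desc_def D_iff_relpow)
  then show thesis
    using that[of "l + n"] L_relpow[of x l z n] assms(1) by auto
qed

lemma Desc_edge: "a \<in> Desc C \<Longrightarrow> (a, b) \<in> E \<Longrightarrow> b \<in> Desc C"
  using D_edge by (fastforce simp: Desc_def)

lemma subset_Desc: "C \<subseteq> Desc C"
  by (auto simp: Desc_def)

lemma cls_subset_Desc:
  assumes C: "C \<in> classes" and z: "z \<in> Desc C"
  shows "cls z \<in> classes" "cls z \<subseteq> Desc C" "z \<in> cls z"
proof -
  obtain x l where x: "l \<ge> k" "x \<in> L l" "C = cls x"
    using C by (rule classesE)
  obtain j where j: "j \<ge> l" "z \<in> L j"
    using Desc_level[of C l z] cls_subset_L[OF x(2,1)] x(3) z by auto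
  then have jk: "j \<ge> k"
    using x(1) by simp
  show "cls z \<in> classes" "z \<in> cls z"
    using cls_in_classes[OF j(2) jk] cls_self[OF j(2) jk] .
  then show "cls z \<subseteq> Desc C"
    using Desc_class_union[OF C _ _ z] by simp
qed

text \<open>The root is \<open>C\<close>. A walk from a vertex of \<open>C\<close> projects to a
  walk of classes, which gives reachability; edges increase the level, so none enters
  \<open>C\<close>; and \<open>parent_cls_unique\<close> makes the arc into a class unique.\<close>

lemma class_quotient_rooted_tree:
  assumes C: "C \<in> classes"
  shows "rooted_directed_tree (with_proj (class_quotient C))"
proof (rule rooted_directed_treeI)
  let ?Q = "with_proj (class_quotient C)"
  show wf: "wf_digraph ?Q"
    by unfold_locales (auto simp: class_quotient_def)
  interpret Q: wf_digraph ?Q by (rule wf)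
  show "C \<in> verts ?Q"
    using C subset_Desc by (simp add: class_quotient_def)
  show "\<exists>p. Q.awalk C p B" if "B \<in> verts ?Q" for B
  proof -
    have B: "B \<in> classes" "B \<subseteq> Desc C"
      using that by (auto simp: class_quotient_def)
    obtain z where z: "z \<in> B"
      using class_nonempty[OF B(1)] by blast
    then obtain x where x: "x \<in> C" "(x, z) \<in> E\<^sup>*"
      using B(2) by (auto simp: Desc_def D_def)
    have "\<exists>p. Q.awalk C p (cls z)"
      using x(2)
    proof (induction rule: rtrancl_induct)
      case base
      have "cls x = C"
        using class_member[OF C x(1)] by metis
      then show ?case
        using \<open>C \<in> verts ?Q\<close> by (intro exI[of _ "[]"]) (simp add: Q.awalk_Nil_iff)
    next
      case (step y z)
      have yD: "y \<in> Desc C"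
        using x(1) step.hyps(1) by (auto simp: Desc_def D_def)
      then have zD: "z \<in> Desc C"
        using step.hyps(2) by (rule Desc_edge)
      have "(cls y, cls z) \<in> arcs ?Q"
        using cls_subset_Desc[OF C yD] cls_subset_Desc[OF C zD] step.hyps(2)
        by (auto simp: class_quotient_def)
      moreover obtain p where "Q.awalk C p (cls y)"
        using step.IH by blast
      ultimately have "Q.awalk C (p @ [(cls y, cls z)]) (cls z)"
        using Q.head_in_verts by (fastforce simp: Q.awalk_Cons_iff Q.awalk_Nil_iff)
      then show ?case by blast
    qed
    moreover have "cls z = B"
      using class_member[OF B(1) z] by metis
    ultimately show ?thesis
      by simp
  qed
  show "head ?Q e \<noteq> C" if e: "e \<in> arcs ?Q" for e
  proof
    assume "head ?Q e = C"
    then obtain a b where ab: "a \<in> Desc C" "b \<in> C" "(a, b) \<in> E"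
      using e by (cases e) (auto simp: class_quotient_def)
    obtain l where l: "b \<in> L l" "C \<subseteq> L l"
      using class_member[OF C ab(2)] by metis
    obtain j where "j \<ge> l" "a \<in> L j"
      using Desc_level[OF l(2) ab(1)] .
    then show False
      using L_unique[OF L_edge[OF _ ab(3)] l(1), of j] by simp
  qed
  show "inj_on (head ?Q) (arcs ?Q)"
  proof (rule inj_onI)
    fix e f assume "e \<in> arcs ?Q" "f \<in> arcs ?Q" "head ?Q e = head ?Q f"
    moreover obtain X Y X' Y' where "e = (X, Y)" "f = (X', Y')"
      by (cases e, cases f)
    ultimately show "e = f"
      using parent_cls_unique[of X X' Y] by (auto simp: class_quotient_def)
  qed
qed

text \<open>A child of a class \<open>B\<close> inside \<open>Desc C\<close> meets
  \<open>Desc C\<close> and is therefore contained in it, so the out-arcs at \<open>B\<close>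
  correspond to all its child classes. As \<open>B\<close> has level at least
  \<open>2 * k - 1\<close>, \<open>card_child_classes\<close> gives their number.\<close>

lemma class_quotient_out_valency:
  assumes C: "C \<in> classes" "C \<subseteq> L l" and l: "l \<ge> 2 * k - 1" and x0: "x0 \<in> L (2 * k - 1)"
  shows "has_out_valency (with_proj (class_quotient C)) (card (child_classes (cls x0)))"
  unfolding has_out_valency_def
proof
  let ?Q = "with_proj (class_quotient C)"
  fix B assume "B \<in> verts ?Q"
  then have B: "B \<in> classes" "B \<subseteq> Desc C"
    by (auto simp: class_quotient_def)
  obtain y where y: "y \<in> B"
    using class_nonempty[OF B(1)] by blast
  then obtain j where j: "j \<ge> l" "y \<in> L j"
    using Desc_level[OF C(2)] B(2) by blast
  have By: "B = cls y"
    using class_member[OF B(1) y] by metis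
  have child: "A \<subseteq> Desc C" if "A \<in> classes" "a \<in> B" "b \<in> A" "(a, b) \<in> E" for A a b
    using Desc_class_union[OF C(1) that(1,3)] Desc_edge[OF _ that(4)] B(2) that(2) by blast
  have "out_arcs ?Q B = {e \<in> parcs (class_quotient C). fst e = B}"
    by (auto simp: out_arcs_def)
  also have "\<dots> = Pair B ` {A \<in> classes. \<exists>a\<in>B. \<exists>b\<in>A. (a, b) \<in> E}"
  proof (intro equalityI subsetI)
    fix e assume "e \<in> {e \<in> parcs (class_quotient C). fst e = B}"
    then show "e \<in> Pair B ` {A \<in> classes. \<exists>a\<in>B. \<exists>b\<in>A. (a, b) \<in> E}"
      by (cases e) (simp add: class_quotient_def)
  next
    fix e assume "e \<in> Pair B ` {A \<in> classes. \<exists>a\<in>B. \<exists>b\<in>A. (a, b) \<in> E}"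
    then obtain A a b where A: "e = (B, A)" "A \<in> classes" "a \<in> B" "b \<in> A" "(a, b) \<in> E"
      by blast
    then show "e \<in> {e \<in> parcs (class_quotient C). fst e = B}"
      using B child[OF A(2-5)] by (auto simp: class_quotient_def)
  qed
  also have "\<dots> = Pair B ` child_classes B"
    using child_classes_eq[OF B(1)] by simp
  finally have "out_arcs ?Q B = Pair B ` child_classes B" .
  moreover have "card (Pair B ` child_classes B) = card (child_classes B)"
    by (intro card_image inj_onI) simp
  ultimately show "finite (out_arcs ?Q B) \<and> out_degree ?Q B = card (child_classes (cls x0))"
    using finite_child_classes(1)[OF B(1)] card_child_classes[OF j(2) _ x0] j(1) l By
    by (simp add: out_degree_def)
qed

lemma finite_classes_level: "finite {C \<in> classes. C \<subseteq> L l}"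
  by (rule finite_subset[of _ "Pow (L l)"]) (auto simp: finite_L)

text \<open>Disjointness comes from \<open>common_descendant_cls\<close>: two classes of level
  \<open>l\<close> with a common descendant coincide.\<close>

lemma partition_Desc:
  assumes "l \<ge> k"
  shows "partition_on (Desc (L l)) (Desc ` {C \<in> classes. C \<subseteq> L l})"
proof (rule partition_onI)
  show "\<Union> (Desc ` {C \<in> classes. C \<subseteq> L l}) = Desc (L l)"
  proof (intro equalityI subsetI)
    fix z assume "z \<in> Desc (L l)"
    then obtain x where x: "x \<in> L l" "z \<in> D x"
      by (auto simp: Desc_def)
    then have "z \<in> Desc (cls x)"
      using cls_self[OF x(1) assms] by (auto simp: Desc_def)
    then show "z \<in> \<Union> (Desc ` {C \<in> classes. C \<subseteq> L l})"
      using cls_in_classes[OF x(1) assms] cls_subset_L[OF x(1) assms] by blast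
  qed (auto simp: Desc_def)
  show "disjnt p q"
    if pq: "p \<in> Desc ` {C \<in> classes. C \<subseteq> L l}" "q \<in> Desc ` {C \<in> classes. C \<subseteq> L l}" "p \<noteq> q" for p q
  proof -
    obtain C C' where C: "p = Desc C" "q = Desc C'" "C \<in> classes" "C' \<in> classes"
      "C \<subseteq> L l" "C' \<subseteq> L l"
      using pq(1,2) by blast
    have "C = C'" if z: "z \<in> Desc C" "z \<in> Desc C'" for z
    proof -
      obtain x x' where x: "x \<in> C" "z \<in> D x" "x' \<in> C'" "z \<in> D x'"
        using z unfolding Desc_def by blast
      have "cls x = cls x'"
        using common_descendant_cls[OF _ _ assms x(2,4)] x(1,3) C(5,6) by blast
      moreover have "C = cls x" "C' = cls x'"
        using class_member[OF C(3) x(1)] class_member[OF C(4) x(3)] by metis+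
      ultimately show ?thesis by simp
    qed
    then show ?thesis
      using pq(3) C(1,2) by (auto simp: disjnt_def)
  qed
  show "{} \<notin> Desc ` {C \<in> classes. C \<subseteq> L l}"
  proof
    assume "{} \<in> Desc ` {C \<in> classes. C \<subseteq> L l}"
    then obtain C where "{} = Desc C" "C \<noteq> {}"
      using class_nonempty by auto
    then show False
      using subset_Desc[of C] by auto
  qed
qed

end

section \<open>Transfer between the digraph and its edge relation\<close>

theorem theorem3p10:
  fixes \<Gamma> :: "'a pair_pre_digraph" and \<alpha> :: 'a
  assumes "pair_loopfree_digraph \<Gamma>" and "asym (parcs \<Gamma>)"
    and "P0 (with_proj \<Gamma>) \<alpha>" and "P1 (with_proj \<Gamma>)" and "P2 (with_proj \<Gamma>) \<alpha>"
  shows "\<exists>k\<ge>1. G3 (with_proj \<Gamma>) \<alpha> k \<and>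
    (\<exists>s\<ge>1. \<forall>l\<ge>2 * k - 1. \<forall>w\<in>rho_classes (with_proj \<Gamma>) \<alpha> k.
       w \<subseteq> desc_at (with_proj \<Gamma>) l \<alpha> \<longrightarrow>
       (let Q = with_proj (quotient_digraph (T_of (with_proj \<Gamma>) w) (rho_classes (with_proj \<Gamma>) \<alpha> k))
        in rooted_directed_tree Q \<and> has_out_valency Q s)) \<and>
    (\<exists>T :: ('a, 'a \<times> 'a) pre_digraph. \<forall>l\<ge>2 * k - 1.
       finite_disjoint_union_of_copies
         (with_proj \<Gamma> \<restriction> desc_set (with_proj \<Gamma>) (desc_at (with_proj \<Gamma>) l \<alpha>)) T \<and>
       (\<exists>w\<in>rho_classes (with_proj \<Gamma>) \<alpha> k.
          w \<subseteq> desc_at (with_proj \<Gamma>) l \<alpha> \<and> digraph_iso T (T_of (with_proj \<Gamma>) w)))"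
proof -
  let ?G = "with_proj \<Gamma>"
  interpret \<Gamma>: pair_loopfree_digraph \<Gamma> by fact
  have wf: "wf_digraph ?G"
    by (rule \<Gamma>.wf_digraph_axioms)
  have root: "\<alpha> \<in> pverts \<Gamma>" and gen: "?G = ?G \<restriction> desc ?G \<alpha>"
    and disj: "\<And>s t. s \<noteq> t \<Longrightarrow> desc_at ?G s \<alpha> \<inter> desc_at ?G t \<alpha> = {}"
    using assms(3) by (auto simp: P0_def)
  obtain m where m: "m > 0" "has_out_valency ?G m"
    using assms(3) by (auto simp: P0_def)
  have desc_at_eq: "desc_at ?G i u = {v. (u, v) \<in> parcs \<Gamma> ^^ i}" if "u \<in> pverts \<Gamma>" for i u
    using desc_at_eq_relpow[OF wf, of u i] assms(2) that by simp
  \<comment> \<open>Disjointness of the sets \<Gamma>^i(\<alpha>) in P0 is uniqueness of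
    levels.\<close>
  interpret H: levelled_relation "parcs \<Gamma>" \<alpha>
    by unfold_locales (use disj desc_at_eq[OF root] in blast)
  have L_eq: "desc_at ?G i \<alpha> = H.L i" for i
    using desc_at_eq[OF root] by (simp add: H.L_def)
  have D_eq: "desc ?G u = H.D u" if "u \<in> pverts \<Gamma>" for u
    using desc_at_eq[OF that] by (auto simp: desc_def H.D_iff_relpow)
  have V_eq: "pverts \<Gamma> = H.D \<alpha>"
    using arg_cong[OF gen, of verts] D_eq[OF root] by simp
  have L_V: "x \<in> pverts \<Gamma>" if "x \<in> H.L i" for x i
    using H.L_subset_D_root[OF that] V_eq by simp
  have induced_desc_iso: "H.desc_iso u (iso_verts f)"
    if "pre_digraph.digraph_isomorphism (?G \<restriction> H.D u) f" "app_iso f (?G \<restriction> H.D u) = ?G" for u f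
    using induced_isoD[OF that] V_eq by (simp add: H.desc_iso_def)
  \<comment> \<open>The finite positive out-valency in P0 gives finitely many and at least one
    successor; P1 gives the isomorphisms at every vertex, and P2 the transitivity on levels.\<close>
  interpret H: homogeneous_levelled_relation "parcs \<Gamma>" \<alpha>
  proof
    fix x assume "x \<in> H.D \<alpha>"
    then have x: "x \<in> pverts \<Gamma>"
      using V_eq by simp
    have succ: "parcs \<Gamma> `` {x} = snd ` out_arcs ?G x"
      by (force simp: out_arcs_def)
    have out: "finite (out_arcs ?G x)" "out_arcs ?G x \<noteq> {}"
      using m x by (auto simp: has_out_valency_def out_degree_def)
    then show "finite (parcs \<Gamma> `` {x})" "\<exists>y. (x, y) \<in> parcs \<Gamma>"
      using succ by auto
    show "\<exists>\<phi>. H.desc_iso x \<phi>"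
    proof -
      have "digraph_iso (?G \<restriction> H.D x) ?G"
        using assms(4) x D_eq[OF x] by (auto simp: P1_def)
      then obtain f where "pre_digraph.digraph_isomorphism (?G \<restriction> H.D x) f"
        "app_iso f (?G \<restriction> H.D x) = ?G"
        unfolding digraph_iso_def by metis
      then show ?thesis
        using induced_desc_iso by blast
    qed
  next
    fix x y i assume "x \<in> H.L i" "y \<in> H.L i"
    then obtain h where h: "is_automorphism ?G h" "iso_verts h x = y"
      using assms(5) L_eq unfolding P2_def by blast
    have "?G \<restriction> H.D \<alpha> = ?G"
      using gen D_eq[OF root] by simp
    then show "\<exists>\<phi>. H.desc_iso \<alpha> \<phi> \<and> \<phi> x = y"
      using induced_desc_iso[of \<alpha> h] h by (auto simp: is_automorphism_def)
  qed
  obtain k where k: "k \<ge> 1"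
    and stable: "\<And>l x z. l \<ge> k \<Longrightarrow> x \<in> H.L l \<Longrightarrow> z \<in> H.D x \<Longrightarrow> H.A 1 z = H.A 1 x"
    using H.ex_stable_level by blast
  interpret H: stable_levelled_relation "parcs \<Gamma>" \<alpha> k
    by unfold_locales (fact k, fact stable)
  have A_eq: "anc ?G x \<inter> desc_at ?G i \<alpha> = H.A i x" for x i
    using L_V D_eq by (auto simp: anc_def L_eq H.A_def)
  have G3: "G3 ?G \<alpha> k"
    unfolding G3_def A_eq unfolding L_eq
  proof (intro allI impI ballI)
    fix l x z assume "k \<le> l" "x \<in> H.L l" "z \<in> desc ?G x"
    then show "H.A 1 z = H.A 1 x"
      using stable[of l x z] D_eq[OF L_V, of x l] by simp
  qed
  have R_eq: "rho ?G \<alpha> k = H.R"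
    unfolding rho_def A_eq unfolding L_eq H.R_def ..
  have classes_eq: "rho_classes ?G \<alpha> k = H.classes"
    unfolding rho_classes_def L_eq R_eq H.classes_def ..
  have Desc_eq: "desc_set ?G w = H.Desc w" if "w \<subseteq> H.L l" for w l
    unfolding desc_set_def H.Desc_def
  proof (rule SUP_cong[OF refl])
    fix x assume "x \<in> w"
    then show "desc ?G x = H.D x"
      using that D_eq[OF L_V, of x l] by blast
  qed
  have T_eq: "T_of ?G w = ?G \<restriction> H.Desc w" if "w \<subseteq> H.L l" for w l
    using Desc_eq[OF that] by (simp add: T_of_def)
  have Q_eq: "quotient_digraph (T_of ?G w) H.classes = H.class_quotient w" if "w \<subseteq> H.L l" for w l
    unfolding T_eq[OF that] quotient_digraph_def H.class_quotient_def
    by (auto simp: arcs_ends_conv)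
  \<comment> \<open>The class of \<open>x0\<close> is the reference from which both the valency
    \<open>s\<close> and the fixed digraph \<open>T\<close> are read off.\<close>
  obtain x0 where x0: "x0 \<in> H.L (2 * k - 1)"
    using H.L_nonempty by blast
  have k': "2 * k - 1 \<ge> k"
    using k by simp
  define s where "s = card (H.child_classes (H.cls x0))"
  define T where "T = ?G \<restriction> H.Desc (H.cls x0)"
  have "s \<ge> 1"
    using H.finite_child_classes[OF H.cls_in_classes[OF x0 k']] by (simp add: s_def Suc_leI card_gt_0_iff)
  moreover have "let Q = with_proj (quotient_digraph (T_of ?G w) (rho_classes ?G \<alpha> k))
      in rooted_directed_tree Q \<and> has_out_valency Q s"
    if "l \<ge> 2 * k - 1" "w \<in> rho_classes ?G \<alpha> k" "w \<subseteq> desc_at ?G l \<alpha>" for l w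
    using that H.class_quotient_rooted_tree[of w] H.class_quotient_out_valency[of w l, OF _ _ _ x0]
    by (simp add: classes_eq L_eq Q_eq s_def)
  moreover have iso: "digraph_iso T (?G \<restriction> H.Desc w)"
    if w: "l \<ge> 2 * k - 1" "w \<in> H.classes" "w \<subseteq> H.L l" for l w
  proof -
    obtain x where x: "x \<in> w"
      using H.class_nonempty[OF w(2)] by blast
    have wx: "w = H.cls x"
      using H.class_member[OF w(2) x] by metis
    have "x \<in> H.L l"
      using x w(3) by blast
    then obtain \<phi> where "bij_betw \<phi> (H.Desc w) (H.Desc (H.cls x0))"
      "\<And>a b. a \<in> H.Desc w \<Longrightarrow> b \<in> H.Desc w \<Longrightarrow> (a, b) \<in> parcs \<Gamma> \<longleftrightarrow> (\<phi> a, \<phi> b) \<in> parcs \<Gamma>"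
      using H.ex_Desc_iso[OF _ w(1) x0] unfolding wx by blast
    then have "digraph_iso (?G \<restriction> H.Desc w) T"
      unfolding T_def by (rule digraph_iso_induceI[OF wf])
    then show ?thesis
      using digraph_iso_swap wf_digraph.wellformed_induce_subgraph[OF wf] by blast
  qed
  moreover have "finite_disjoint_union_of_copies (?G \<restriction> desc_set ?G (desc_at ?G l \<alpha>)) T"
    if l: "l \<ge> 2 * k - 1" for l
    unfolding finite_disjoint_union_of_copies_def
  proof (intro exI conjI ballI)
    let ?H = "?G \<restriction> desc_set ?G (desc_at ?G l \<alpha>)"
    let ?P = "H.Desc ` {w \<in> H.classes. w \<subseteq> H.L l}"
    have H_eq: "?H = ?G \<restriction> H.Desc (H.L l)"
      using Desc_eq[OF subset_refl] by (simp add: L_eq)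
    show "finite ?P"
      using H.finite_classes_level by simp
    show part: "partition_on (verts ?H) ?P"
      using H.partition_Desc l k' by (simp add: H_eq)
    show "\<exists>X\<in>?P. tail ?H e \<in> X \<and> head ?H e \<in> X" if "e \<in> arcs ?H" for e
    proof -
      obtain a b where e: "e = (a, b)" by fastforce
      \<comment> \<open>The tail lies in some part, and every part is closed under successors, so
        the head lies in the same part.\<close>
      then have ab: "(a, b) \<in> parcs \<Gamma>" "a \<in> \<Union> ?P"
        using that partition_onD1[OF part] by (auto simp: H_eq)
      then show ?thesis
        using e H.Desc_edge by fastforce
    qed
    fix X assume "X \<in> ?P"
    then obtain w where w: "w \<in> H.classes" "w \<subseteq> H.L l" "X = H.Desc w" by blast
    then have "X \<subseteq> H.Desc (H.L l)"
      by (auto simp: H.Desc_def)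
    then have "?H \<restriction> X = ?G \<restriction> X"
      unfolding H_eq by (intro pre_digraph.equality) auto
    then show "digraph_iso T (?H \<restriction> X)"
      using iso[OF l w(1,2)] w(3) by simp
  qed
  moreover have "\<exists>w\<in>rho_classes ?G \<alpha> k. w \<subseteq> desc_at ?G l \<alpha> \<and> digraph_iso T (T_of ?G w)"
    if l: "l \<ge> 2 * k - 1" for l
  proof -
    have lk: "l \<ge> k"
      using l k' by simp
    obtain x where x: "x \<in> H.L l"
      using H.L_nonempty by blast
    have w: "H.cls x \<in> H.classes" "H.cls x \<subseteq> H.L l"
      using H.cls_in_classes[OF x lk] H.cls_subset_L[OF x lk] .
    then have "digraph_iso T (T_of ?G (H.cls x))"
      using iso[OF l w] T_eq[OF w(2)] by simp
    then show ?thesis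
      unfolding classes_eq L_eq using w by blast
  qed
  ultimately show ?thesis
    using k G3 by blast
qed

end
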